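(* On the unit square $[0,1]^2$ with vertices $\mathbf{v}_1=(0,0)$, $\mathbf{v}_2=(1,0)$, $\mathbf{v}_3=(1,1)$, $\mathbf{v}_4=(0,1)$, define $$\xi_{11}=(1-x)(1-y)(1-x-y),\quad \xi_{22}=x(1-y)(x-y),\quad \xi_{33}=xy(-1+x+y),\quad \xi_{44}=(1-x)y(y-x),$$ $$\xi_{12}=(1-x)x(1-y),\quad \xi_{23}=x(1-y)y,\quad \xi_{34}=(1-x)xy,\quad \xi_{14}=(1-x)(1-y)y.$$ Then, for all $\mathbf{x}=(x,y)^T\in[0,1]^2$, with indices taken modulo $4$ and $\xi_{45}=\xi_{41}=\xi_{14}$: (1) $\sum_{i=1}^4\xi_{ii}+\sum_{i=1}^4 2\xi_{i(i+1)}=1$; (2) $\sum_{i=1}^4\mathbf{v}_i\xi_{ii}+\sum_{i=1}^4 2\mathbf{v}_{i(i+1)}\xi_{i(i+1)}=\mathbf{x}$; (3) $\sum_{i=1}^4\mathbf{v}_i\mathbf{v}_i^T\xi_{ii}+\sum_{i=1}^4(\mathbf{v}_i\mathbf{v}_{i+1}^T+\mathbf{v}_{i+1}\mathbf{v}_i^T)\xi_{i(i+1)}=\mathbf{x}\mathbf{x}^T$.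
   Context: Vertices are viewed as column vectors in $\mathbb{R}^2$, and $\mathbf{v}_{i(i+1)}:=(\mathbf{v}_i+\mathbf{v}_{i+1})/2$ is the midpoint of the corresponding edge. *)

theory Defs
  imports "HOL-Analysis.Analysis"
begin

(* Indices are read modulo 4, so index 4 is the residue class 0 and index 5 is index 1. *)
definition vert :: "nat \<Rightarrow> real^2" where
  "vert i =
    (if i mod 4 = 1 then vector [0, 0]
     else if i mod 4 = 2 then vector [1, 0]
     else if i mod 4 = 3 then vector [1, 1]
     else vector [0, 1])"

(* Keying on the unordered pair of residues builds in xi i j = xi j i, hence
   xi 4 5 = xi 4 1 = xi 1 4. The opposite pairs {1, 3} and {2, 4} carry no function here. *)
definition xi :: "nat \<Rightarrow> nat \<Rightarrow> real^2 \<Rightarrow> real" where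
  "xi i j p =
    (let x = p $ 1; y = p $ 2; e = {i mod 4, j mod 4} in
     if e = {1} then (1 - x) * (1 - y) * (1 - x - y)
     else if e = {2} then x * (1 - y) * (x - y)
     else if e = {3} then x * y * (-1 + x + y)
     else if e = {0} then (1 - x) * y * (y - x)
     else if e = {1, 2} then (1 - x) * x * (1 - y)
     else if e = {2, 3} then x * (1 - y) * y
     else if e = {3, 0} then (1 - x) * x * y
     else if e = {1, 0} then (1 - x) * (1 - y) * y
     else undefined)"

definition outer :: "real^2 \<Rightarrow> real^2 \<Rightarrow> real^2^2" where
  "outer u w = (columnvector u :: real^1^2) ** transpose (columnvector w)"

end

theory Submission
  imports Defs
begin

text \<open>
  Let \<open>\<lambda>\<^sub>1 = (1 - x)(1 - y)\<close>, \<open>\<lambda>\<^sub>2 = x(1 - y)\<close>, \<open>\<lambda>\<^sub>3 = xy\<close>, \<open>\<lambda>\<^sub>4 = (1 - x)y\<close> be the bilinear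
  coordinates on the square. They sum to 1 and reproduce \<open>p\<close> as \<open>\<Sum>\<lambda>\<^sub>i v\<^sub>i\<close>. Expanding a bilinear
  expression \<open>B (\<Sum>\<lambda>\<^sub>i u\<^sub>i) (\<Sum>\<lambda>\<^sub>i w\<^sub>i)\<close> uses all products \<open>\<lambda>\<^sub>i \<lambda>\<^sub>j\<close>, including those
  of the two diagonals. These two are equal, \<open>\<lambda>\<^sub>1 \<lambda>\<^sub>3 = \<lambda>\<^sub>2 \<lambda>\<^sub>4 = b\<close>, and the diagonal values of \<open>B\<close>
  can be traded for vertex and edge values because the square is a parallelogram,
  \<open>v\<^sub>1 + v\<^sub>3 = v\<^sub>2 + v\<^sub>4\<close> (lemma \<open>parallelogram_diagonal_exchange\<close>). The trade turns the vertex
  coefficient \<open>\<lambda>\<^sub>i\<^sup>2\<close> into \<open>\<lambda>\<^sub>i\<^sup>2 - b\<close> and the edge coefficient \<open>\<lambda>\<^sub>i \<lambda>\<^sub>i\<^sub>+\<^sub>1\<close> into \<open>\<lambda>\<^sub>i \<lambda>\<^sub>i\<^sub>+\<^sub>1 + b\<close>;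
  these are exactly the functions \<open>\<xi>\<close>.

  So a single identity (lemma \<open>bilinear_reproduction\<close>) gives all three claims: take for \<open>B\<close> the
  product of reals with \<open>u\<^sub>i = w\<^sub>i = 1\<close>, the scalar multiplication with \<open>u\<^sub>i = 1\<close>, \<open>w\<^sub>i = v\<^sub>i\<close>,
  and the outer product with \<open>u\<^sub>i = w\<^sub>i = v\<^sub>i\<close>.
\<close>

text \<open>
  The vertex terms complete the diagonal terms to
  \<open>B (u\<^sub>1 + u\<^sub>3) (w\<^sub>1 + w\<^sub>3) + B (u\<^sub>2 + u\<^sub>4) (w\<^sub>2 + w\<^sub>4)\<close>. The two sums of opposite vertices
  in the second argument are equal; swapping them leaves only edge terms.
\<close>
lemma (in bounded_bilinear) parallelogram_diagonal_exchange:
  assumes "w1 + w3 = w2 + w4"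
  shows "(prod u1 w3 + prod u3 w1) + (prod u2 w4 + prod u4 w2)
      + (prod u1 w1 + prod u2 w2 + prod u3 w3 + prod u4 w4)
    = (prod u1 w2 + prod u2 w1) + (prod u2 w3 + prod u3 w2)
      + (prod u3 w4 + prod u4 w3) + (prod u4 w1 + prod u1 w4)"
proof -
  have "prod (u1 + u3) (w1 + w3) + prod (u2 + u4) (w2 + w4)
      = prod (u1 + u3) (w2 + w4) + prod (u2 + u4) (w1 + w3)"
    using assms by simp
  then show ?thesis
    by (simp add: add_left add_right algebra_simps)
qed

text \<open>
  With equal diagonal products, both diagonals enter the expansion of the right side with the
  same coefficient \<open>b\<close>, so the exchange applies to them jointly: it takes \<open>b\<close> from every vertex
  and gives \<open>b\<close> to every edge. The identity is homogeneous of degree 2 in the weights.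
\<close>
lemma (in bounded_bilinear) serendipity_expansion:
  fixes l1 l2 l3 l4 b :: real
  assumes "w1 + w3 = w2 + w4" and b13: "l1 * l3 = b" and b24: "l2 * l4 = b"
  shows "(l1\<^sup>2 - b) *\<^sub>R prod u1 w1 + (l2\<^sup>2 - b) *\<^sub>R prod u2 w2
      + (l3\<^sup>2 - b) *\<^sub>R prod u3 w3 + (l4\<^sup>2 - b) *\<^sub>R prod u4 w4
      + ((l1 * l2 + b) *\<^sub>R (prod u1 w2 + prod u2 w1) + (l2 * l3 + b) *\<^sub>R (prod u2 w3 + prod u3 w2)
      + (l3 * l4 + b) *\<^sub>R (prod u3 w4 + prod u4 w3) + (l4 * l1 + b) *\<^sub>R (prod u4 w1 + prod u1 w4))
    = prod (l1 *\<^sub>R u1 + l2 *\<^sub>R u2 + l3 *\<^sub>R u3 + l4 *\<^sub>R u4)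
        (l1 *\<^sub>R w1 + l2 *\<^sub>R w2 + l3 *\<^sub>R w3 + l4 *\<^sub>R w4)"
    (is "?lhs = ?rhs")
proof -
  let ?V = "prod u1 w1 + prod u2 w2 + prod u3 w3 + prod u4 w4"
  let ?D = "(prod u1 w3 + prod u3 w1) + (prod u2 w4 + prod u4 w2)"
  let ?E = "(prod u1 w2 + prod u2 w1) + (prod u2 w3 + prod u3 w2)
      + (prod u3 w4 + prod u4 w3) + (prod u4 w1 + prod u1 w4)"
  let ?S = "l1\<^sup>2 *\<^sub>R prod u1 w1 + l2\<^sup>2 *\<^sub>R prod u2 w2 + l3\<^sup>2 *\<^sub>R prod u3 w3 + l4\<^sup>2 *\<^sub>R prod u4 w4
      + ((l1 * l2) *\<^sub>R (prod u1 w2 + prod u2 w1) + (l2 * l3) *\<^sub>R (prod u2 w3 + prod u3 w2)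
      + (l3 * l4) *\<^sub>R (prod u3 w4 + prod u4 w3) + (l4 * l1) *\<^sub>R (prod u4 w1 + prod u1 w4))"
  have "?lhs = ?S + b *\<^sub>R (?E - ?V)"
    by (simp add: algebra_simps)
  also have "?E - ?V = ?D"
    using parallelogram_diagonal_exchange[OF assms(1), of u1 u3 u2 u4]
    by (metis add_diff_cancel_right')
  also have "b *\<^sub>R ?D = (l1 * l3) *\<^sub>R (prod u1 w3 + prod u3 w1)
      + (l2 * l4) *\<^sub>R (prod u2 w4 + prod u4 w2)"
    by (simp only: b13 b24 scaleR_add_right)
  also have "?S + \<dots> = ?rhs"
    by (simp add: add_left add_right scaleR_left scaleR_right power2_eq_square algebra_simps)
  finally show ?thesis .
qed

lemma sum_one_to_four:
  fixes f :: "nat \<Rightarrow> 'a::comm_monoid_add"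
  shows "(\<Sum>i=1..4. f i) = f 1 + f 2 + f 3 + f 4"
  by (simp add: eval_nat_numeral add.assoc)

lemma xi_values:
  fixes p :: "real^2"
  shows "xi 1 1 p = (1 - p$1) * (1 - p$2) * (1 - p$1 - p$2)"
    and "xi 2 2 p = p$1 * (1 - p$2) * (p$1 - p$2)"
    and "xi 3 3 p = p$1 * p$2 * (-1 + p$1 + p$2)"
    and "xi 4 4 p = (1 - p$1) * p$2 * (p$2 - p$1)"
    and "xi 1 2 p = (1 - p$1) * p$1 * (1 - p$2)"
    and "xi 2 3 p = p$1 * (1 - p$2) * p$2"
    and "xi 3 4 p = (1 - p$1) * p$1 * p$2"
    and "xi 4 5 p = (1 - p$1) * (1 - p$2) * p$2"
  by (simp_all add: xi_def Let_def doubleton_eq_iff)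

lemma vert_values:
  shows "vert 1 = vector [0, 0]" and "vert 2 = vector [1, 0]"
    and "vert 3 = vector [1, 1]" and "vert 4 = vector [0, 1]" and "vert 5 = vector [0, 0]"
  by (simp_all add: vert_def)

text \<open>
  The functions \<open>\<xi>\<close> are the corrected products \<open>\<lambda>\<^sub>i\<^sup>2 - b\<close> and \<open>\<lambda>\<^sub>i \<lambda>\<^sub>i\<^sub>+\<^sub>1 + b\<close> of the
  bilinear coordinates, with \<open>b = x(1 - x)y(1 - y)\<close>. For instance,
  \<open>\<lambda>\<^sub>1\<^sup>2 - b = (1 - x)(1 - y)((1 - x)(1 - y) - xy) = (1 - x)(1 - y)(1 - x - y)\<close>.
  The assumptions on the index 5 close the cycle of vertices.
\<close>
lemma (in bounded_bilinear) bilinear_reproduction: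
  fixes p :: "real^2"
  assumes "w 1 + w 3 = w 2 + w 4" and "u 5 = u 1" and "w 5 = w (1::nat)"
  defines "x \<equiv> p$1" and "y \<equiv> p$2"
  shows "(\<Sum>i=1..4. xi i i p *\<^sub>R prod (u i) (w i))
      + (\<Sum>i=1..4. xi i (i + 1) p *\<^sub>R (prod (u i) (w (i + 1)) + prod (u (i + 1)) (w i)))
    = prod (((1 - x) * (1 - y)) *\<^sub>R u 1 + (x * (1 - y)) *\<^sub>R u 2 + (x * y) *\<^sub>R u 3 + ((1 - x) * y) *\<^sub>R u 4)
        (((1 - x) * (1 - y)) *\<^sub>R w 1 + (x * (1 - y)) *\<^sub>R w 2 + (x * y) *\<^sub>R w 3 + ((1 - x) * y) *\<^sub>R w 4)"
proof -
  define b where "b = x * (1 - x) * y * (1 - y)"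
  define l1 l2 l3 l4 where l: "l1 = (1 - x) * (1 - y)" "l2 = x * (1 - y)" "l3 = x * y" "l4 = (1 - x) * y"
  have diagonals: "l1 * l3 = b" "l2 * l4 = b"
    by (simp_all add: l b_def)
  have vertices: "xi 1 1 p = l1\<^sup>2 - b" "xi 2 2 p = l2\<^sup>2 - b" "xi 3 3 p = l3\<^sup>2 - b" "xi 4 4 p = l4\<^sup>2 - b"
    unfolding xi_values l b_def x_def y_def by algebra+
  have edges: "xi 1 2 p = l1 * l2 + b" "xi 2 3 p = l2 * l3 + b" "xi 3 4 p = l3 * l4 + b"
    "xi 4 5 p = l4 * l1 + b"
    unfolding xi_values l b_def x_def y_def by algebra+
  have succ: "(1::nat) + 1 = 2" "(2::nat) + 1 = 3" "(3::nat) + 1 = 4" "(4::nat) + 1 = 5"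
    by simp_all
  show ?thesis
    unfolding sum_one_to_four succ vertices edges assms(2,3) l[symmetric]
    by (rule serendipity_expansion[OF assms(1) diagonals])
qed

lemma bilinear_coordinates_reproduce_point:
  fixes p :: "real^2"
  shows "((1 - p$1) * (1 - p$2)) *\<^sub>R vert 1 + (p$1 * (1 - p$2)) *\<^sub>R vert 2
    + (p$1 * p$2) *\<^sub>R vert 3 + ((1 - p$1) * p$2) *\<^sub>R vert 4 = p"
  by (simp add: vert_values vec_eq_iff forall_2 algebra_simps del: One_nat_def)

lemma bounded_bilinear_outer: "bounded_bilinear outer"
proof -
  have entry: "outer u w $ i $ j = u $ i * w $ j" for u w i j
    by (simp add: outer_def matrix_matrix_mult_def columnvector_def transpose_def)
  show ?thesis
    by (rule bilinear_conv_bounded_bilinear[THEN iffD1])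
      (auto simp: bilinear_def vec_eq_iff entry algebra_simps intro!: linearI)
qed

theorem theorem4p1:
  fixes p :: "real^2"
  assumes "p \<in> cbox (vector [0, 0]) (vector [1, 1])"
  shows "(\<Sum>i=1..4. xi i i p) + (\<Sum>i=1..4. 2 * xi i (i + 1) p) = 1
    \<and> (\<Sum>i=1..4. xi i i p *\<^sub>R vert i)
        + (\<Sum>i=1..4. (2 * xi i (i + 1) p) *\<^sub>R midpoint (vert i) (vert (i + 1))) = p
    \<and> (\<Sum>i=1..4. xi i i p *\<^sub>R outer (vert i) (vert i))
        + (\<Sum>i=1..4. xi i (i + 1) p *\<^sub>R
             (outer (vert i) (vert (i + 1)) + outer (vert (i + 1)) (vert i))) = outer p p"
proof (intro conjI)
  have parallelogram: "vert 1 + vert 3 = vert 2 + vert 4" and period: "vert 5 = vert 1"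
    by (simp_all add: vert_values vec_eq_iff forall_2 del: One_nat_def)
  have partition_of_unity: "((1 - p$1) * (1 - p$2)) *\<^sub>R (1::real) + (p$1 * (1 - p$2)) *\<^sub>R 1
      + (p$1 * p$2) *\<^sub>R 1 + ((1 - p$1) * p$2) *\<^sub>R 1 = 1"
    by (simp add: algebra_simps)
  show "(\<Sum>i=1..4. xi i i p) + (\<Sum>i=1..4. 2 * xi i (i + 1) p) = 1"
    using bounded_bilinear.bilinear_reproduction
      [OF bounded_bilinear_mult, of "\<lambda>_. 1::real" "\<lambda>_. 1" p]
    unfolding partition_of_unity by (simp add: mult.commute)
  have edge_midpoint: "(2 * c) *\<^sub>R midpoint v w = c *\<^sub>R (w + v)" for c :: real and v w :: "real^2"
    by (simp add: midpoint_def add.commute)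
  show "(\<Sum>i=1..4. xi i i p *\<^sub>R vert i)
      + (\<Sum>i=1..4. (2 * xi i (i + 1) p) *\<^sub>R midpoint (vert i) (vert (i + 1))) = p"
    using bounded_bilinear.bilinear_reproduction
      [OF bounded_bilinear_scaleR parallelogram refl period, of "\<lambda>_. 1" p]
    unfolding partition_of_unity bilinear_coordinates_reproduce_point edge_midpoint scaleR_one
    by simp
  show "(\<Sum>i=1..4. xi i i p *\<^sub>R outer (vert i) (vert i))
      + (\<Sum>i=1..4. xi i (i + 1) p *\<^sub>R
           (outer (vert i) (vert (i + 1)) + outer (vert (i + 1)) (vert i))) = outer p p"
    using bounded_bilinear.bilinear_reproduction
      [OF bounded_bilinear_outer parallelogram period period, of p]
    unfolding bilinear_coordinates_reproduce_point .
qed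

end
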